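(* The following asymptotic equalities hold. (i) For $h=2/q\to 0$ with $q=2\nu+1$, $\nu=2,3,\dots$, $$A(h)=h+\frac{\pi^2}{16}h^3+\frac{5\pi^4}{768}h^5+O(h^7).$$ (ii) For $h=3/q\to 0$ with $q=3\nu+1$, $\nu=2,3,\dots$, $$A(h)=h+\frac{16\pi^2}{243}h^3-\frac{16\pi^3\sqrt{3}}{2187}h^4+\frac{448\pi^4}{59049}h^5+O(h^6).$$ (iii) For $h=3/q\to 0$ with $q=3\nu+2$, $\nu=2,3,\dots$, $$A(h)=h+\frac{16\pi^2}{243}h^3+\frac{16\pi^3\sqrt{3}}{2187}h^4+\frac{448\pi^4}{59049}h^5+O(h^6).$$
   Context: For $0<h\le 1/2$, $K(h)$ denotes the class of continuous $1$-periodic even functions $f:\mathbb{R}\to\mathbb{R}$ such that: (1) $f(x)=\sum_{n=0}^{\infty}a_n\cos(2\pi nx)$; (2) $a_n\ge 0$ for all $n=0,1,2,\dots$; (3) $f(0)=\sum_{n=0}^{\infty}a_n=1$; (4) $f(x)=0$ for $h\le |x|\le 1/2$. Define $A(h)=\sup_{f\in K(h)}a_0=\sup_{f\in K(h)}\int_{-h}^{h}f(x)\,dx$. In each part, $h$ tends to $0$ along the indicated sequence of values (i.e. $\nu\to\infty$ through the integers). *)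

theory Defs
  imports "HOL-Analysis.Analysis" "HOL-Library.Landau_Symbols"
begin

definition cosine_expansion :: "(nat \<Rightarrow> real) \<Rightarrow> (real \<Rightarrow> real) \<Rightarrow> bool" where
  "cosine_expansion a f \<longleftrightarrow>
     (\<forall>x. (\<lambda>n. a n * cos (2 * pi * real n * x)) sums f x) \<and>
     (\<forall>n. a n \<ge> 0) \<and> f 0 = 1 \<and> a sums 1"

definition class_K :: "real \<Rightarrow> (real \<Rightarrow> real) set" where
  "class_K h = {f. continuous_on UNIV f \<and> (\<forall>x. f (x + 1) = f x) \<and> (\<forall>x. f (- x) = f x) \<and>
     (\<exists>a. cosine_expansion a f) \<and> (\<forall>x. h \<le> \<bar>x\<bar> \<and> \<bar>x\<bar> \<le> 1/2 \<longrightarrow> f x = 0)}"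

(* a 0 is the integral of f over one period, hence determined by f. The set is bounded
   above (bdd_above_extremal_A) and, for 0 < h <= 1/2, nonempty: it contains the value for
   the periodised triangle max 0 (1 - |x| / h). So Sup is a genuine supremum there. *)
definition extremal_A :: "real \<Rightarrow> real" where
  "extremal_A h = Sup {a 0 | a f. f \<in> class_K h \<and> cosine_expansion a f}"

lemma cosine_expansion_integral:
  assumes "cosine_expansion a f"
  shows "(f has_integral a 0) {-1/2..1/2}"
proof -
  let ?g = "\<lambda>n x. a n * cos (2 * pi * real n * x)"
  have a: "a sums 1" "\<And>n. a n \<ge> 0" and fs: "\<And>x. (\<lambda>n. ?g n x) sums f x"
    using assms by (auto simp: cosine_expansion_def)
  have "uniform_limit {-1/2..1/2} (\<lambda>n x. \<Sum>i<n. ?g i x) (\<lambda>x. suminf (\<lambda>i. ?g i x)) sequentially"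
    by (rule Weierstrass_m_test[where M = a])
       (use a in \<open>auto simp: abs_mult sums_iff intro!: mult_left_le\<close>)
  then have ul: "uniform_limit {-1/2..1/2} (\<lambda>n x. \<Sum>i<n. ?g i x) f sequentially"
    using fs by (simp add: sums_iff)
  have one: "(?g n has_integral (if n = 0 then a 0 else 0)) {-1/2..1/2}" for n
  proof (cases "n = 0")
    case True
    then show ?thesis using has_integral_const_real[of "a 0" "-1/2" "1/2"] by simp
  next
    case False
    have "(?g n has_integral
        (a n * sin (2 * pi * real n * (1/2)) / (2 * pi * real n)
         - a n * sin (2 * pi * real n * (-1/2)) / (2 * pi * real n))) {-1/2..1/2}"
      by (rule fundamental_theorem_of_calculus)
         (use False in \<open>auto intro!: derivative_eq_intros
            simp flip: has_real_derivative_iff_has_vector_derivative simp: field_simps\<close>)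
    moreover have "sin (pi * real n) = 0" by (simp add: mult.commute)
    ultimately show ?thesis using False by simp
  qed
  have part: "((\<lambda>x. \<Sum>i<n. ?g i x) has_integral (\<Sum>i<n. if i = 0 then a 0 else 0)) {-1/2..1/2}" for n
    by (intro has_integral_sum one) auto
  obtain I J where I: "\<And>n. ((\<lambda>x. \<Sum>i<n. ?g i x) has_integral I n) {-1/2..1/2}"
    and J: "(f has_integral J) {-1/2..1/2}" and lim: "I \<longlonglongrightarrow> J"
    by (rule uniform_limit_integral[OF ul]) (auto intro!: continuous_intros)
  have "I n = (\<Sum>i<n. if i = 0 then a 0 else 0)" for n
    using has_integral_unique[OF I part] .
  then have "\<forall>\<^sub>F n in sequentially. I n = a 0"
    by (intro eventually_sequentiallyI[of 1]) (simp add: sum.delta)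
  then have "I \<longlonglongrightarrow> a 0" by (rule tendsto_eventually)
  with lim J show ?thesis using LIMSEQ_unique by blast
qed

lemma extremal_A_eq_integral:
  assumes "0 < h" "h \<le> 1/2"
  shows "extremal_A h = (SUP f\<in>class_K h. integral {-h..h} f)"
proof -
  have "a 0 = integral {-h..h} f" if K: "f \<in> class_K h" and a: "cosine_expansion a f" for a f
  proof -
    have z: "f x = 0" if "x \<notin> {-h..h}" "x \<in> {-1/2..1/2}" for x
    proof -
      have "h \<le> \<bar>x\<bar>" "\<bar>x\<bar> \<le> 1/2" using that by auto
      then show ?thesis using K by (auto simp: class_K_def)
    qed
    have "((\<lambda>x. if x \<in> {-h..h} then f x else 0) has_integral a 0) {-1/2..1/2}"
      by (rule has_integral_eq[OF _ cosine_expansion_integral[OF a]]) (use z in auto)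
    then have "(f has_integral a 0) {-h..h}"
      by (subst (asm) has_integral_restrict) (use assms in auto)
    then show ?thesis by (simp add: integral_unique)
  qed
  moreover have "\<exists>a. cosine_expansion a f" if "f \<in> class_K h" for f
    using that by (auto simp: class_K_def)
  ultimately have "{a 0 | a f. f \<in> class_K h \<and> cosine_expansion a f} = (\<lambda>f. integral {-h..h} f) ` class_K h"
    unfolding image_def by (intro Collect_cong) metis
  then show ?thesis by (simp add: extremal_A_def)
qed

lemma bdd_above_extremal_A:
  "bdd_above {a 0 | a f. f \<in> class_K h \<and> cosine_expansion a f}"
proof (rule bdd_aboveI[of _ 1])
  fix y assume "y \<in> {a 0 | a f. f \<in> class_K h \<and> cosine_expansion a f}"
  then obtain a where y: "y = a 0" and a: "a sums 1" "\<And>n. a n \<ge> 0"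
    by (auto simp: cosine_expansion_def)
  have "sum a {0} \<le> suminf a"
    by (rule sum_le_suminf) (use a in \<open>auto simp: sums_iff\<close>)
  then show "y \<le> 1" using a y by (simp add: sums_iff)
qed

end

theory Submission
  imports Defs "HOL-Real_Asymp.Real_Asymp"
begin

text \<open>
  For a rational \<open>h = p / q\<close> the extremal problem is a finite linear program on the grid \<open>\<int>/q\<close>.
  Sampling \<open>f\<close> in \<open>class_K h\<close> at the points \<open>k / q\<close> gives an even sequence supported on \<open>\<bar>k\<bar> < p\<close>
  whose discrete Fourier transform is nonnegative and at frequency \<open>0\<close> is at least \<open>q * a 0\<close>
  (\<open>grid_samples\<close>). Conversely, interpolating such a sequence linearly gives a member of the class with
  equality (\<open>grid_interpolant\<close>). So \<open>q * extremal_A (p / q)\<close> is the largest sum of an even sequence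
  supported on \<open>\<bar>k\<bar> < p\<close>, with value \<open>1\<close> at \<open>0\<close> and nonnegative transform (\<open>extremal_A_eqI\<close>).

  For \<open>p = 2\<close> and odd \<open>q\<close> this leaves one unknown, bounded by the constraint at the grid angle closest
  to \<open>pi\<close>, and the value is \<open>1 + 1 / cos (pi / q)\<close>. For \<open>p = 3\<close> the transform is a quadratic in
  \<open>cos t\<close>; the optimal one vanishes at the two grid angles that enclose \<open>2 * pi / 3\<close>, and a
  three-point quadrature rule with nonnegative weights proves optimality. The asymptotic formulas are
  the Taylor expansions of these two closed forms. The residue of \<open>q\<close> modulo \<open>3\<close> decides which
  of the two angles is closer to \<open>2 * pi / 3\<close>; exchanging them replaces \<open>h\<close> by \<open>- h\<close> in the
  expansion of the optimal value, which is why the two cases differ in the sign of the \<open>h ^ 4\<close> term.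

  The analytic ingredient is that the periodised tent function is the sum of a cosine series with
  nonnegative coefficients. It is obtained as a second difference of
  \<open>\<Sum>n. cos (n * t) / n\<^sup>2 = (t - pi)\<^sup>2 / 4 - pi\<^sup>2 / 12\<close> for \<open>0 \<le> t \<le> 2 * pi\<close>, an identity that comes from
  integrating \<open>Im (Ln (1 - r * cis t))\<close> and letting \<open>r\<close> tend to \<open>1\<close>.
\<close>

section \<open>The Fourier series of the second Bernoulli polynomial\<close>

text \<open>
  The imaginary part of \<open>Ln (1 - z) = - (\<Sum>n. z ^ n / n)\<close>. Staying strictly inside the unit
  disc makes the differentiated cosine series converge uniformly.
\<close>

lemma sine_series_Im_Ln:
  fixes r t :: real
  assumes "0 \<le> r" "r < 1"
  shows "(\<lambda>n. - (r ^ n * sin (real n * t) / real n)) sums Im (Ln (1 - of_real r * cis t))"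
proof -
  have "(\<lambda>n. - ((- (- (of_real r * cis t))) ^ n) / of_nat n) sums Ln (1 + - (of_real r * cis t))"
    by (rule Ln_series') (use assms in \<open>simp add: norm_mult\<close>)
  then have "(\<lambda>n. - ((of_real r * cis t) ^ n) / of_nat n) sums Ln (1 - of_real r * cis t)"
    by simp
  then have "(\<lambda>n. Im (- ((of_real r * cis t) ^ n) / of_nat n)) sums Im (Ln (1 - of_real r * cis t))"
    by (simp add: sums_complex_iff)
  moreover have "Im (- ((of_real r * cis t) ^ n) / of_nat n) = - (r ^ n * sin (real n * t) / real n)" for n
  proof -
    have "- ((of_real r * cis t) ^ n) / of_nat n = of_real (- (r ^ n) / real n) * cis (real n * t)"
      by (simp add: power_mult_distrib Complex.DeMoivre)
    then show ?thesis by (simp only: times_complex.sel Re_complex_of_real Im_complex_of_real cis.sel) simp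
  qed
  ultimately show ?thesis by (simp only:)
qed

lemma Re_one_minus_pos:
  fixes r t :: real
  assumes "0 \<le> r" "r \<le> 1" "r < 1 \<or> 0 < t \<and> t < 2 * pi"
  shows "Re (1 - of_real r * cis t) > 0"
proof (cases "r < 1")
  case True
  have "r * cos t \<le> r * 1" using assms by (intro mult_left_mono) auto
  then show ?thesis using True by simp
next
  case False
  then have "r = 1" "0 < t" "t < 2 * pi" using assms by auto
  moreover have "0 < sin (t / 2)" using \<open>0 < t\<close> \<open>t < 2 * pi\<close> by (intro sin_gt_zero) auto
  moreover have "1 - cos t = 2 * (sin (t / 2))\<^sup>2" using cos_double_sin[of "t / 2"] by simp
  ultimately show ?thesis by simp
qed

text \<open>
  Here \<open>1 - cis t = 2 * sin (t / 2) * cis ((t - pi) / 2)\<close> with a positive modulus and an angle in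
  \<open>(- pi / 2, pi / 2)\<close>, so no branch correction occurs. This is the sawtooth to which the sine
  series tends at the boundary of the disc.
\<close>

lemma Im_Ln_one_minus_cis:
  assumes "0 < t" "t < 2 * pi"
  shows "Im (Ln (1 - cis t)) = (t - pi) / 2"
proof -
  define s where "s = sin (t / 2)"
  have s: "s > 0" unfolding s_def using assms by (intro sin_gt_zero) auto
  have t: "sin t = 2 * s * cos (t / 2)" "cos t = 1 - 2 * s\<^sup>2"
    using sin_double[of "t / 2"] cos_double_sin[of "t / 2"] by (simp_all add: s_def)
  have "Ln (1 - cis t) = Complex (ln (2 * s)) ((t - pi) / 2)"
  proof (rule Ln_unique)
    have e: "exp (ln (2 * s)) = 2 * s" using s by simp
    have "cos ((t - pi) / 2) = s" "sin ((t - pi) / 2) = - cos (t / 2)"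
      by (simp_all add: s_def diff_divide_distrib cos_diff sin_diff)
    then show "exp (Complex (ln (2 * s)) ((t - pi) / 2)) = 1 - cis t"
      by (simp only: complex_eq_iff Re_exp Im_exp complex.sel e) (simp add: t power2_eq_square)
  qed (use assms in auto)
  then show ?thesis by simp
qed

text \<open>
  The real part of the dilogarithm on the unit circle. The summand at \<open>n = 0\<close> is \<open>1 / 0 = 0\<close>.
\<close>

definition cosine_dilog :: "real \<Rightarrow> real" where
  "cosine_dilog t = (\<Sum>n. cos (real n * t) / (real n)\<^sup>2)"

lemma inverse_squares_sums': "(\<lambda>n. 1 / (real n)\<^sup>2) sums (pi\<^sup>2 / 6)"
  using inverse_squares_sums sums_Suc_iff[of "\<lambda>n. 1 / (real n)\<^sup>2" "pi\<^sup>2 / 6"]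
  by (simp add: add.commute)

lemma cosine_dilog_sums: "(\<lambda>n. cos (real n * t) / (real n)\<^sup>2) sums cosine_dilog t"
  unfolding cosine_dilog_def
  by (rule summable_sums, rule summable_comparison_test[OF _ sums_summable[OF inverse_squares_sums']])
     (auto simp: divide_right_mono)

lemma continuous_cosine_dilog: "continuous_on UNIV cosine_dilog"
proof (rule uniform_limit_theorem)
  show "uniform_limit UNIV (\<lambda>n x. \<Sum>i<n. cos (real i * x) / (real i)\<^sup>2) cosine_dilog sequentially"
    unfolding cosine_dilog_def
    by (rule Weierstrass_m_test[where M = "\<lambda>n. 1 / (real n)\<^sup>2"])
       (use inverse_squares_sums' in \<open>auto simp: sums_iff divide_right_mono\<close>)
  show "\<forall>\<^sub>F n in sequentially. continuous_on UNIV (\<lambda>x. \<Sum>i<n. cos (real i * x) / (real i)\<^sup>2)"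
    unfolding divide_inverse by (intro always_eventually allI continuous_intros)
qed auto

text \<open>
  Termwise differentiation on the boundary circle would require the conditionally convergent sine
  series. Instead the identity is integrated for the Abel means
  \<open>\<Sum>n. r ^ n * cos (n * t) / n\<^sup>2\<close>, whose derivative is \<open>Im (Ln (1 - r * cis t))\<close>, and then
  \<open>r \<longlonglongrightarrow> 1\<close>: the derivative is bounded by \<open>pi\<close>, so dominated convergence applies on the integral
  side and Tannery's theorem on the series side.
\<close>

lemma cosine_dilog_diff:
  assumes "0 < s" "s \<le> t" "t < 2 * pi"
  shows "cosine_dilog t - cosine_dilog s = (t - pi)\<^sup>2 / 4 - (s - pi)\<^sup>2 / 4"
proof -
  define r where "r k = 1 - 1 / (real k + 2)" for k
  have r: "0 \<le> r k" "r k < 1" for k by (auto simp: r_def field_simps)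
  have r_lim: "r \<longlonglongrightarrow> 1" unfolding r_def by real_asymp
  define u where "u k x = (\<Sum>n. r k ^ n * cos (real n * x) / (real n)\<^sup>2)" for k x
  define \<phi> where "\<phi> k x = Im (Ln (1 - of_real (r k) * cis x))" for k x
  have deriv: "(u k has_real_derivative \<phi> k x) (at x)" for k x
  proof -
    have summ: "summable (\<lambda>n. r k ^ n)" using r[of k] by (intro summable_geometric) auto
    have "(u k has_real_derivative (\<Sum>n. - (r k ^ n * sin (real n * x) / real n))) (at x)"
      unfolding u_def
    proof (rule has_field_derivative_series'(2)[where S = UNIV and ?x0.0 = 0])
      show "((\<lambda>x. r k ^ n * cos (real n * x) / (real n)\<^sup>2) has_real_derivative
          - (r k ^ n * sin (real n * y) / real n)) (at y within UNIV)" for n y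
        by (cases "n = 0") (auto intro!: derivative_eq_intros simp: field_simps power2_eq_square)
      show "uniformly_convergent_on UNIV (\<lambda>n x. \<Sum>i<n. - (r k ^ i * sin (real i * x) / real i))"
      proof (rule Weierstrass_m_test'[OF _ summ])
        fix n x
        have "\<bar>sin (real n * x)\<bar> / real n \<le> 1" by (cases "n = 0") (auto simp: field_simps intro: order_trans[OF abs_sin_le_one])
        then have "r k ^ n * (\<bar>sin (real n * x)\<bar> / real n) \<le> r k ^ n"
          using r[of k] by (intro mult_left_le) auto
        then show "norm (- (r k ^ n * sin (real n * x) / real n)) \<le> r k ^ n"
          using r[of k] by (simp add: abs_mult)
      qed
      show "summable (\<lambda>n. r k ^ n * cos (real n * 0) / (real n)\<^sup>2)"
      proof (rule summable_comparison_test[OF _ summ], intro exI allI impI)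
        fix n
        have "r k ^ n * (1 / (real n)\<^sup>2) \<le> r k ^ n"
          using r[of k] by (intro mult_left_le) (cases "n = 0", auto simp: field_simps)
        then show "norm (r k ^ n * cos (real n * 0) / (real n)\<^sup>2) \<le> r k ^ n"
          using r[of k] by simp
      qed
    qed auto
    then show ?thesis using sine_series_Im_Ln[OF r] by (simp add: sums_iff \<phi>_def)
  qed
  have int: "(\<phi> k has_integral (u k t - u k s)) {s..t}" for k
    using assms by (intro fundamental_theorem_of_calculus)
      (auto simp flip: has_real_derivative_iff_has_vector_derivative
            intro: has_field_derivative_at_within deriv)
  have "(\<lambda>k. integral {s..t} (\<phi> k)) \<longlonglongrightarrow> integral {s..t} (\<lambda>x. (x - pi) / 2)"
  proof (rule dominated_convergence(2))
    show "\<phi> k integrable_on {s..t}" for k using int by (rule has_integral_integrable)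
    show "(\<lambda>x. pi) integrable_on {s..t}" by (rule integrable_const_ivl)
    show "norm (\<phi> k x) \<le> pi" for k x
    proof -
      have "1 - of_real (r k) * cis x \<noteq> (0::complex)"
        using Re_one_minus_pos[of "r k" x] r[of k] by (metis less_irrefl less_imp_le zero_complex.sel(1))
      then show ?thesis using mpi_less_Im_Ln[of "1 - of_real (r k) * cis x"] Im_Ln_le_pi[of "1 - of_real (r k) * cis x"]
        by (auto simp: \<phi>_def)
    qed
    show "(\<lambda>k. \<phi> k x) \<longlonglongrightarrow> (x - pi) / 2" if "x \<in> {s..t}" for x
    proof -
      have x: "0 < x" "x < 2 * pi" using that assms by auto
      have "Re (1 - of_real 1 * cis x) > 0" using x by (intro Re_one_minus_pos) auto
      then have "1 - of_real 1 * cis x \<notin> \<real>\<^sub>\<le>\<^sub>0" by (auto simp: complex_nonpos_Reals_iff)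
      then have "(\<lambda>k. \<phi> k x) \<longlonglongrightarrow> Im (Ln (1 - of_real 1 * cis x))"
        unfolding \<phi>_def by (intro tendsto_intros r_lim)
      then show ?thesis using Im_Ln_one_minus_cis[OF x] by simp
    qed
  qed
  moreover have "integral {s..t} (\<phi> k) = u k t - u k s" for k using int by (rule integral_unique)
  moreover have "integral {s..t} (\<lambda>x. (x - pi) / 2) = (t - pi)\<^sup>2 / 4 - (s - pi)\<^sup>2 / 4"
    using assms by (intro integral_unique fundamental_theorem_of_calculus)
      (auto simp flip: has_real_derivative_iff_has_vector_derivative intro!: derivative_eq_intros)
  ultimately have "(\<lambda>k. u k t - u k s) \<longlonglongrightarrow> (t - pi)\<^sup>2 / 4 - (s - pi)\<^sup>2 / 4"
    by (simp only:)
  moreover have "(\<lambda>k. u k x) \<longlonglongrightarrow> cosine_dilog x" for x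
  proof -
    have "((\<lambda>k. r k ^ n * cos (real n * x) / (real n)\<^sup>2) \<longlonglongrightarrow> cos (real n * x) / (real n)\<^sup>2)" for n
    proof -
      have "((\<lambda>k. r k ^ n * (cos (real n * x) / (real n)\<^sup>2)) \<longlonglongrightarrow> 1 ^ n * (cos (real n * x) / (real n)\<^sup>2))"
        by (intro tendsto_mult tendsto_power r_lim tendsto_const)
      then show ?thesis by simp
    qed
    moreover have "norm (r k ^ n * cos (real n * x) / (real n)\<^sup>2) \<le> 1 / (real n)\<^sup>2" for k n
      using r[of k] by (auto simp: abs_mult intro!: divide_right_mono mult_le_one power_le_one)
    ultimately show ?thesis
      unfolding u_def cosine_dilog_def
      using tannerys_theorem[of "\<lambda>n k. r k ^ n * cos (real n * x) / (real n)\<^sup>2"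
          "\<lambda>n. cos (real n * x) / (real n)\<^sup>2" sequentially "\<lambda>n. 1 / (real n)\<^sup>2"]
        sums_summable[OF inverse_squares_sums']
      by (auto intro!: always_eventually)
  qed
  then have "(\<lambda>k. u k t - u k s) \<longlonglongrightarrow> cosine_dilog t - cosine_dilog s"
    by (intro tendsto_diff)
  ultimately show ?thesis using LIMSEQ_unique by blast
qed

text \<open>
  The classical Fourier series of the second Bernoulli polynomial. The Basel sum at \<open>t = 0\<close> fixes
  the constant of integration, and continuity carries the formula to the endpoints.
\<close>

lemma cosine_dilog_eq:
  assumes "0 \<le> t" "t \<le> 2 * pi"
  shows "cosine_dilog t = (t - pi)\<^sup>2 / 4 - pi\<^sup>2 / 12"
proof -
  define g where "g t = cosine_dilog t - (t - pi)\<^sup>2 / 4" for t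
  have cont: "continuous_on (closure {0<..<2 * pi}) g"
    unfolding g_def by (intro continuous_intros continuous_on_subset[OF continuous_cosine_dilog]) auto
  have const: "g x = g pi" if "x \<in> {0<..<2 * pi}" for x
    using cosine_dilog_diff[of x pi] cosine_dilog_diff[of pi x] that
    by (cases "x \<le> pi") (auto simp: g_def)
  have all: "g x = g pi" if "x \<in> {0..2 * pi}" for x
    using continuous_constant_on_closure[OF cont const, of x] that by (simp add: closure_greaterThanLessThan)
  have "cosine_dilog 0 = pi\<^sup>2 / 6"
    using inverse_squares_sums' by (simp add: cosine_dilog_def sums_iff)
  then have "g 0 = - pi\<^sup>2 / 12" by (simp add: g_def)
  then show ?thesis using all[of 0] all[of t] assms by (simp add: g_def)
qed

section \<open>The triangle wave\<close>

text \<open>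
  For \<open>0 < d \<le> 1/2\<close> the function \<open>triangle_wave d\<close> is the 1-periodic extension of the tent
  \<open>max 0 (1 - \<bar>x\<bar> / d)\<close>, and \<open>triangle_coeff d\<close> are its cosine coefficients. Since \<open>cosine_dilog\<close> is
  quadratic on each period, its second difference with step \<open>d\<close> is constant except near the
  integers; this gives the tent in a form whose cosine series is known from the outset.
\<close>

definition triangle_coeff :: "real \<Rightarrow> nat \<Rightarrow> real" where
  "triangle_coeff d n = (if n = 0 then d else 2 * (sin (pi * real n * d))\<^sup>2 / (d * pi\<^sup>2 * (real n)\<^sup>2))"

definition triangle_wave :: "real \<Rightarrow> real \<Rightarrow> real" where
  "triangle_wave d x = d + (cosine_dilog (2 * pi * x) - cosine_dilog (2 * pi * (x + d)) / 2
     - cosine_dilog (2 * pi * (x - d)) / 2) / (d * pi\<^sup>2)"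

lemma triangle_coeff_nonneg: "0 \<le> d \<Longrightarrow> 0 \<le> triangle_coeff d n"
  by (simp add: triangle_coeff_def)

lemma triangle_wave_sums:
  "(\<lambda>n. triangle_coeff d n * cos (2 * pi * real n * x)) sums triangle_wave d x"
proof -
  let ?c = "\<lambda>n x. cos (real n * (2 * pi * x)) / (real n)\<^sup>2"
  have "(\<lambda>n. (if n = 0 then d else 0) + (?c n x - ?c n (x + d) / 2 - ?c n (x - d) / 2) / (d * pi\<^sup>2))
      sums triangle_wave d x"
    unfolding triangle_wave_def
    by (intro sums_add sums_diff sums_divide cosine_dilog_sums)
       (use sums_single[of 0 "\<lambda>_. d"] in simp)
  moreover have "(if n = 0 then d else 0) + (?c n x - ?c n (x + d) / 2 - ?c n (x - d) / 2) / (d * pi\<^sup>2)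
      = triangle_coeff d n * cos (2 * pi * real n * x)" for n
  proof (cases "n = 0")
    case True
    then show ?thesis by (simp add: triangle_coeff_def)
  next
    case False
    define A B where "A = 2 * pi * real n * x" and "B = pi * real n * d"
    have *: "real n * (2 * pi * x) = A" "real n * (2 * pi * (x + d)) = A + 2 * B"
      "real n * (2 * pi * (x - d)) = A - 2 * B"
      by (simp_all add: A_def B_def algebra_simps)
    have "?c n x - ?c n (x + d) / 2 - ?c n (x - d) / 2
        = (cos A - cos (A + 2 * B) / 2 - cos (A - 2 * B) / 2) / (real n)\<^sup>2"
      unfolding * by (simp add: diff_divide_distrib)
    also have "cos A - cos (A + 2 * B) / 2 - cos (A - 2 * B) / 2 = cos A * (1 - cos (2 * B))"
      by (simp add: cos_add cos_diff field_simps)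
    also have "\<dots> = 2 * (sin B)\<^sup>2 * cos A" by (simp add: cos_double_sin)
    finally show ?thesis using False by (simp add: triangle_coeff_def A_def B_def mult_ac)
  qed
  ultimately show ?thesis by simp
qed

lemma continuous_triangle_wave: "continuous_on UNIV (triangle_wave d)"
  unfolding triangle_wave_def divide_inverse
  by (intro continuous_intros continuous_on_compose2[OF continuous_cosine_dilog]) auto

lemma triangle_wave_0:
  assumes "0 < d" "d \<le> 1"
  shows "triangle_wave d 0 = 1"
proof -
  have "cosine_dilog (2 * pi * (0 - d)) = cosine_dilog (2 * pi * d)"
    by (simp add: cosine_dilog_def)
  moreover have "cosine_dilog (2 * pi * d) = (2 * pi * d - pi)\<^sup>2 / 4 - pi\<^sup>2 / 12"
    using assms by (intro cosine_dilog_eq) auto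
  moreover have "cosine_dilog 0 = (0 - pi)\<^sup>2 / 4 - pi\<^sup>2 / 12"
    by (rule cosine_dilog_eq) auto
  ultimately show ?thesis
    using assms by (simp add: triangle_wave_def field_simps power2_eq_square)
qed

text \<open>
  On this range all three arguments of \<open>cosine_dilog\<close> lie in one period, where the second
  difference of a quadratic is the constant that the summand \<open>d\<close> cancels.
\<close>

lemma triangle_wave_eq_0:
  assumes "0 < d" "d \<le> \<bar>x\<bar>" "\<bar>x\<bar> \<le> 1 - d"
  shows "triangle_wave d x = 0"
proof -
  have minus: "triangle_wave d (- y) = triangle_wave d y" for y
    using triangle_wave_sums[of d "- y"] triangle_wave_sums[of d y] by (auto dest: sums_unique2)
  define y where "y = \<bar>x\<bar>"
  have y: "d \<le> y" "y \<le> 1 - d" using assms by (auto simp: y_def)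
  have H: "cosine_dilog (2 * pi * z) = (2 * pi * z - pi)\<^sup>2 / 4 - pi\<^sup>2 / 12" if "0 \<le> z" "z \<le> 1" for z
    using that by (intro cosine_dilog_eq) auto
  have "triangle_wave d y = 0"
    unfolding triangle_wave_def using y assms(1)
    by (subst (1 2 3) H) (auto simp: field_simps power2_eq_square)
  then show ?thesis using minus[of y] by (auto simp: y_def abs_if split: if_splits)
qed

section \<open>Reduction to a linear program on a grid\<close>

text \<open>
  The discrete Fourier transform on \<open>\<int>/q\<close> of the even sequence with value \<open>1\<close> at \<open>0\<close>, values
  \<open>F k\<close> at \<open>\<plusminus>k\<close> for \<open>0 < k < p\<close>, and \<open>0\<close> elsewhere.
\<close>

definition grid_transform :: "nat \<Rightarrow> nat \<Rightarrow> (nat \<Rightarrow> real) \<Rightarrow> nat \<Rightarrow> real" where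
  "grid_transform p q F j = 1 + 2 * (\<Sum>k=1..<p. F k * cos (2 * pi * real j * (real k / real q)))"

text \<open>
  The sum is the real part of a full geometric sum of a \<open>q\<close>-th root of unity, hence \<open>q\<close> or \<open>0\<close>.
\<close>

lemma sum_cos_grid_nonneg:
  assumes "q > 0"
  shows "(\<Sum>k<q. cos (2 * pi * of_int m * (real k / real q))) \<ge> 0"
proof -
  define z where "z = cis (2 * pi * of_int m / real q)"
  have "z ^ q = cis (2 * pi * of_int m)" using assms by (simp add: z_def Complex.DeMoivre)
  also have "\<dots> = 1" by (simp add: cis_multiple_2pi)
  finally have zq: "z ^ q = 1" .
  have "Re (z ^ k) = cos (2 * pi * of_int m * (real k / real q))" for k
    by (simp add: z_def Complex.DeMoivre mult_ac)
  then have "(\<Sum>k<q. cos (2 * pi * of_int m * (real k / real q))) = Re (\<Sum>k<q. z ^ k)"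
    by simp
  also have "\<dots> \<ge> 0"
    by (cases "z = 1") (simp_all add: zq geometric_sum)
  finally show ?thesis .
qed

lemma sum_cos_prod_grid_nonneg:
  assumes "q > 0"
  shows "(\<Sum>k<q. cos (2 * pi * real n * (real k / real q)) * cos (2 * pi * real j * (real k / real q))) \<ge> 0"
proof -
  have "cos (2 * pi * real n * x) * cos (2 * pi * real j * x) =
      (cos (2 * pi * of_int (int n + int j) * x) + cos (2 * pi * of_int (int n - int j) * x)) / 2" for x
    by (simp add: algebra_simps cos_add cos_diff)
  then have "(\<Sum>k<q. cos (2 * pi * real n * (real k / real q)) * cos (2 * pi * real j * (real k / real q)))
      = ((\<Sum>k<q. cos (2 * pi * of_int (int n + int j) * (real k / real q))) +
         (\<Sum>k<q. cos (2 * pi * of_int (int n - int j) * (real k / real q)))) / 2"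
    by (simp only: sum_divide_distrib[symmetric] sum.distrib)
  also have "\<dots> \<ge> 0"
    by (intro divide_nonneg_nonneg add_nonneg_nonneg sum_cos_grid_nonneg assms) simp
  finally show ?thesis .
qed

lemma grid_transform_eq_sum:
  assumes f: "f \<in> class_K (real p / real q)" and pq: "0 < p" "2 * p \<le> q"
  shows "(\<Sum>k<q. f (real k / real q) * cos (2 * pi * real j * (real k / real q)))
       = grid_transform p q (\<lambda>k. f (real k / real q)) j"
proof -
  have per: "f (x + 1) = f x" and even: "f (- x) = f x" for x
    using f by (auto simp: class_K_def)
  have f0: "f 0 = 1" using f by (auto simp: class_K_def cosine_expansion_def)
  have zero: "f x = 0" if "real p / real q \<le> x" "x \<le> 1 - real p / real q" for x
  proof (cases "x \<le> 1 / 2")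
    case True
    moreover have "0 \<le> x" using that(1) by (rule order_trans[rotated]) simp
    ultimately show ?thesis using f that by (auto simp: class_K_def)
  next
    case False
    have "0 \<le> real p / real q" by simp
    then have "real p / real q \<le> \<bar>x - 1\<bar>" "\<bar>x - 1\<bar> \<le> 1 / 2" using that False by linarith+
    then have "f (x - 1) = 0" using f by (auto simp: class_K_def)
    then show ?thesis using per[of "x - 1"] by simp
  qed
  define g where "g k = f (real k / real q) * cos (2 * pi * real j * (real k / real q))" for k
  have g_mid: "g k = 0" if "p \<le> k" "k \<le> q - p" for k
  proof -
    have "real k \<le> real q - real p" using that pq by linarith
    then have "f (real k / real q) = 0"
      using that pq by (intro zero) (auto simp: field_simps)
    then show ?thesis by (simp add: g_def)
  qed
  have g_refl: "g (q - k) = g k" if "k < p" for k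
  proof -
    have *: "real (q - k) / real q = - (real k / real q) + 1" using that pq by (simp add: field_simps of_nat_diff)
    have "cos (2 * pi * real j * (- (real k / real q) + 1)) = cos (2 * pi * real j - 2 * pi * real j * (real k / real q))"
      by (simp add: algebra_simps)
    also have "\<dots> = cos (2 * pi * real j * (real k / real q))"
      using cos_2npi[of j] sin_2npi[of j] by (simp add: cos_diff mult.commute mult.left_commute)
    finally show ?thesis by (simp only: g_def * per even)
  qed
  have g_refl': "g (q - k) = g k" if "k \<in> {q - p + 1..<q}" for k
  proof -
    have "q - k < p" "q - (q - k) = k" using that pq by auto
    then show ?thesis using g_refl[of "q - k"] by simp
  qed
  have "sum g {..<q} = sum g ({0} \<union> {1..<p} \<union> {q - p + 1..<q})"
    using pq by (intro sum.mono_neutral_right) (auto intro!: g_mid simp: not_le not_less)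
  also have "\<dots> = g 0 + sum g {1..<p} + sum g {q - p + 1..<q}"
    using pq by (subst sum.union_disjoint; force)+
  also have "sum g {q - p + 1..<q} = sum g {1..<p}"
    by (rule sum.reindex_bij_witness[of _ "\<lambda>k. q - k" "\<lambda>k. q - k"]) (use pq g_refl' in auto)
  finally show ?thesis by (simp add: f0 grid_transform_def g_def)
qed

text \<open>
  Aliasing: transforming the samples on the grid adds up, with positive weights, the coefficients
  \<open>a n\<close> with \<open>n\<close> congruent to \<open>j\<close> or \<open>- j\<close> modulo \<open>q\<close>. So the transform is nonnegative, and at frequency \<open>0\<close> the sum
  contains \<open>a 0\<close> with weight \<open>q\<close>.
\<close>

lemma grid_samples:
  assumes f: "f \<in> class_K (real p / real q)" and a: "cosine_expansion a f" and pq: "0 < p" "2 * p \<le> q"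
  shows "0 \<le> grid_transform p q (\<lambda>k. f (real k / real q)) j"
    and "real q * a 0 \<le> grid_transform p q (\<lambda>k. f (real k / real q)) 0"
proof -
  have a_nonneg: "a n \<ge> 0" for n using a by (simp add: cosine_expansion_def)
  have q: "q > 0" using pq by simp
  let ?S = "\<lambda>j n. \<Sum>k<q. cos (2 * pi * real n * (real k / real q)) * cos (2 * pi * real j * (real k / real q))"
  have sums: "(\<lambda>n. a n * ?S j n) sums grid_transform p q (\<lambda>k. f (real k / real q)) j" for j
  proof -
    have "(\<lambda>n. \<Sum>k<q. a n * cos (2 * pi * real n * (real k / real q)) * cos (2 * pi * real j * (real k / real q)))
        sums (\<Sum>k<q. f (real k / real q) * cos (2 * pi * real j * (real k / real q)))"
      by (intro sums_sum sums_mult2) (use a in \<open>unfold cosine_expansion_def, blast\<close>)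
    then show ?thesis
      unfolding grid_transform_eq_sum[OF f pq, symmetric] sum_distrib_left by (simp only: mult.assoc)
  qed
  have nonneg: "0 \<le> a n * ?S j n" for j n
    using a_nonneg sum_cos_prod_grid_nonneg[OF q] by (rule mult_nonneg_nonneg)
  show "0 \<le> grid_transform p q (\<lambda>k. f (real k / real q)) j"
    using sums_le[OF nonneg sums_zero sums] .
  have "(\<lambda>n. if n = 0 then real q * a 0 else 0) sums (real q * a 0)"
    using sums_single[of 0 "\<lambda>_. real q * a 0"] by simp
  then show "real q * a 0 \<le> grid_transform p q (\<lambda>k. f (real k / real q)) 0"
    by (rule sums_le[rotated, OF _ sums]) (use nonneg[of _ 0] in \<open>auto simp: mult.commute\<close>)
qed

text \<open>
  Conversely, the piecewise linear interpolation of a sequence on the grid multiplies its transform by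
  the coefficients of the triangle wave. Nonnegativity survives, and \<open>2 * p \<le> q\<close> keeps the
  shifted tents from wrapping around the period.
\<close>

lemma grid_interpolant:
  assumes pq: "0 < p" "2 * p \<le> q" and pos: "\<And>j. 0 \<le> grid_transform p q F j"
  obtains f a where "f \<in> class_K (real p / real q)" "cosine_expansion a f"
    "a 0 = grid_transform p q F 0 / real q"
proof -
  define d where "d = 1 / real q"
  have d: "0 < d" "d \<le> 1 / 2" "real p * d \<le> 1 / 2" using pq by (auto simp: d_def field_simps)
  define a where "a n = triangle_coeff d n * grid_transform p q F n" for n
  define f where "f x = triangle_wave d x +
      (\<Sum>k=1..<p. F k * (triangle_wave d (x - real k * d) + triangle_wave d (x + real k * d)))" for x
  have sums: "(\<lambda>n. a n * cos (2 * pi * real n * x)) sums f x" for x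
  proof -
    have "(\<lambda>n. triangle_coeff d n * cos (2 * pi * real n * x) + (\<Sum>k=1..<p. F k *
        (triangle_coeff d n * cos (2 * pi * real n * (x - real k * d)) +
         triangle_coeff d n * cos (2 * pi * real n * (x + real k * d))))) sums f x"
      unfolding f_def by (intro sums_add sums_sum sums_mult triangle_wave_sums)
    moreover have "triangle_coeff d n * cos (2 * pi * real n * x) + (\<Sum>k=1..<p. F k *
        (triangle_coeff d n * cos (2 * pi * real n * (x - real k * d)) +
         triangle_coeff d n * cos (2 * pi * real n * (x + real k * d))))
        = a n * cos (2 * pi * real n * x)" for n
    proof -
      have "F k * (triangle_coeff d n * cos (2 * pi * real n * (x - real k * d)) +
           triangle_coeff d n * cos (2 * pi * real n * (x + real k * d)))
         = triangle_coeff d n * cos (2 * pi * real n * x) * 2 * (F k * cos (2 * pi * real n * (real k / real q)))" for k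
        by (simp add: d_def distrib_left right_diff_distrib cos_add cos_diff algebra_simps)
      then show ?thesis
        unfolding a_def grid_transform_def
        by (simp only: sum_distrib_left[symmetric]) (simp only: ring_distribs mult_ac mult_1)
    qed
    ultimately show ?thesis by simp
  qed
  have f0: "f 0 = 1"
  proof -
    have "triangle_wave d (0 - real k * d) = 0" "triangle_wave d (0 + real k * d) = 0" if "k \<in> {1..<p}" for k
    proof -
      have "1 * d \<le> real k * d" "(real k + 1) * d \<le> real p * d"
        using that d by (intro mult_right_mono; force)+
      then show "triangle_wave d (0 - real k * d) = 0" "triangle_wave d (0 + real k * d) = 0"
        using d by (intro triangle_wave_eq_0; simp add: algebra_simps)+
    qed
    then show ?thesis using triangle_wave_0[of d] d by (simp add: f_def)
  qed
  have "a sums 1" using sums[of 0] f0 by simp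
  moreover have "0 \<le> a n" for n
    using pos d triangle_coeff_nonneg[of d] by (simp add: a_def)
  ultimately have a: "cosine_expansion a f"
    unfolding cosine_expansion_def using sums f0 by blast
  have even: "f (- x) = f x" for x
    using sums[of x] sums[of "- x"] by (auto dest: sums_unique2)
  have vanish: "f x = 0" if "real p * d \<le> x" "x \<le> 1 / 2" for x
  proof -
    have "triangle_wave d (x - real k * d) = 0" "triangle_wave d (x + real k * d) = 0" if "k < p" for k
    proof -
      have "(real k + 1) * d \<le> real p * d" "0 * d \<le> real k * d"
        using that d by (intro mult_right_mono; force)+
      then have "real k * d + d \<le> real p * d" "0 \<le> real k * d" by (simp_all add: distrib_right)
      then show "triangle_wave d (x - real k * d) = 0" "triangle_wave d (x + real k * d) = 0"
        using d \<open>real p * d \<le> x\<close> \<open>x \<le> 1 / 2\<close> by (intro triangle_wave_eq_0; linarith)+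
    qed
    from this this[of 0] show ?thesis using pq by (simp add: f_def)
  qed
  have "f \<in> class_K (real p / real q)"
    unfolding class_K_def
  proof (intro CollectI conjI allI impI)
    show "continuous_on UNIV f"
      unfolding f_def by (intro continuous_intros continuous_on_compose2[OF continuous_triangle_wave]) auto
    show "f (x + 1) = f x" for x
    proof -
      have "cos (2 * pi * real n * (x + 1)) = cos (2 * pi * real n * x)" for n
        using cos_2npi[of n] sin_2npi[of n]
        by (simp add: distrib_left cos_add mult.commute mult.left_commute)
      then show ?thesis using sums[of x] sums[of "x + 1"] by (auto dest: sums_unique2)
    qed
    show "f x = 0" if "real p / real q \<le> \<bar>x\<bar> \<and> \<bar>x\<bar> \<le> 1 / 2" for x
      using vanish[of "\<bar>x\<bar>"] even[of x] that by (auto simp: d_def abs_if split: if_splits)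
  qed (use a even in auto)
  moreover have "a 0 = grid_transform p q F 0 / real q"
    by (simp add: a_def triangle_coeff_def d_def)
  ultimately show ?thesis using a that by blast
qed

text \<open>
  Together the last two lemmas turn \<open>extremal_A (p / q)\<close> into a linear program with \<open>p - 1\<close> unknowns
  and the constraints \<open>0 \<le> grid_transform p q G j\<close>.
\<close>

theorem extremal_A_eqI:
  assumes pq: "0 < p" "2 * p \<le> q" and pos: "\<And>j. 0 \<le> grid_transform p q F j"
    and opt: "\<And>G. (\<And>j. 0 \<le> grid_transform p q G j) \<Longrightarrow> grid_transform p q G 0 \<le> V"
    and V: "grid_transform p q F 0 = V"
  shows "extremal_A (real p / real q) = V / real q"
  unfolding extremal_A_def
proof (rule cSup_eq_maximum)
  obtain f a where "f \<in> class_K (real p / real q)" "cosine_expansion a f" "a 0 = V / real q"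
    using grid_interpolant[OF pq pos] V by metis
  then show "V / real q \<in> {a 0 |a f. f \<in> class_K (real p / real q) \<and> cosine_expansion a f}"
    by (intro CollectI exI[of _ a] exI[of _ f]) simp
next
  fix y assume "y \<in> {a 0 |a f. f \<in> class_K (real p / real q) \<and> cosine_expansion a f}"
  then obtain a f where y: "y = a 0" "f \<in> class_K (real p / real q)" "cosine_expansion a f" by auto
  have "real q * a 0 \<le> V"
    using grid_samples[OF y(2,3) pq] opt by (meson order_trans)
  then show "y \<le> V / real q" using pq y by (simp add: field_simps)
qed

section \<open>Closed forms for two and three samples\<close>

text \<open>
  By periodicity and evenness of the cosine, every grid angle can be moved into \<open>[0, pi]\<close>, where the
  cosine is monotone.
\<close>

lemma cos_grid_fold:
  assumes "q > 0"
  obtains i :: nat where "2 * i \<le> q" "cos (2 * pi * real j * (1 / real q)) = cos (2 * pi * real i * (1 / real q))"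
proof -
  define r where "r = j mod q"
  have r: "r < q" using assms by (simp add: r_def)
  have "real j = real r + real q * real (j div q)"
    unfolding r_def by (metis mod_mult_div_eq of_nat_add of_nat_mult)
  then have "2 * pi * real j * (1 / real q) = 2 * pi * real r * (1 / real q) + 2 * real (j div q) * pi"
    using assms by (simp add: field_simps)
  then have jr: "cos (2 * pi * real j * (1 / real q)) = cos (2 * pi * real r * (1 / real q))"
    by (simp add: cos_add cos_2npi sin_2npi)
  show ?thesis
  proof (cases "2 * r \<le> q")
    case True
    then show ?thesis using jr that by blast
  next
    case False
    have "2 * pi * real (q - r) * (1 / real q) = 2 * pi - 2 * pi * real r * (1 / real q)"
      using r by (simp add: of_nat_diff field_simps)
    then have "cos (2 * pi * real (q - r) * (1 / real q)) = cos (2 * pi * real r * (1 / real q))"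
      by (simp add: cos_diff)
    then show ?thesis using jr that[of "q - r"] False r by simp
  qed
qed

lemma cos_grid_antimono:
  assumes "i \<le> k" "2 * k \<le> q" "q > 0"
  shows "cos (2 * pi * real k * (1 / real q)) \<le> cos (2 * pi * real i * (1 / real q))"
proof (rule cos_monotone_0_pi_le)
  have "2 * real k \<le> real q" using assms(2) by linarith
  then show "2 * pi * real k * (1 / real q) \<le> pi"
    using assms by (simp add: field_simps)
qed (use assms in \<open>auto simp: divide_right_mono\<close>)

text \<open>
  With a single unknown only the constraint with the smallest cosine matters. For odd \<open>q\<close> the grid
  misses the angle \<open>pi\<close>, and the smallest value is \<open>- cos (pi / q)\<close>, attained at \<open>j = (q - 1) / 2\<close>.
\<close>

theorem extremal_A_two:
  assumes "\<nu> \<ge> 2" "real q = 2 * real \<nu> + 1"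
  shows "extremal_A (2 / real q) = (1 + 1 / cos (pi / real q)) / real q"
proof -
  have q': "q = 2 * \<nu> + 1" using assms(2) by linarith
  note q = assms(2)
  define c where "c = cos (pi / real q)"
  have c: "c > 0" unfolding c_def using assms by (intro cos_gt_zero) (auto simp: field_simps)
  have T: "grid_transform 2 q F j = 1 + 2 * F 1 * cos (2 * pi * real j * (1 / real q))" for F j
    by (simp add: grid_transform_def numeral_2_eq_2)
  have lowest: "cos (2 * pi * real \<nu> * (1 / real q)) = - c"
  proof -
    have "2 * pi * real \<nu> * (1 / real q) = pi - pi / real q" by (simp add: q field_simps)
    then show ?thesis by (simp add: c_def)
  qed
  have "extremal_A (real 2 / real q) = (1 + 1 / c) / real q"
  proof (rule extremal_A_eqI[where F = "\<lambda>_. 1 / (2 * c)"])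
    show "0 \<le> grid_transform 2 q (\<lambda>_. 1 / (2 * c)) j" for j
    proof -
      obtain i where i: "2 * i \<le> q" "cos (2 * pi * real j * (1 / real q)) = cos (2 * pi * real i * (1 / real q))"
        using cos_grid_fold[of q j] q' by auto
      have "- c \<le> cos (2 * pi * real j * (1 / real q))"
        unfolding i(2) lowest[symmetric] using i(1) q' by (intro cos_grid_antimono) auto
      then show ?thesis using c by (simp add: T field_simps)
    qed
    show "grid_transform 2 q G 0 \<le> 1 + 1 / c" if "\<And>j. 0 \<le> grid_transform 2 q G j" for G
      using that[of \<nu>] c unfolding T lowest by (simp add: field_simps)
    show "grid_transform 2 q (\<lambda>_. 1 / (2 * c)) 0 = 1 + 1 / c" by (simp add: T)
  qed (use assms q' in auto)
  then show ?thesis by (simp add: c_def)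
qed

text \<open>
  The linear functional sending a quadratic in \<open>cos t\<close> to its mean over the circle, which is the
  normalised constant \<open>1\<close> for \<open>P\<close>, is written as a combination of the values at \<open>1\<close>, \<open>c1\<close> and \<open>c2\<close>.
  For \<open>c2 < - 1 / 2 < c1 \<le> 0\<close> the weights are nonnegative, so this quadrature rule is a dual certificate
  for the linear program with \<open>p = 3\<close>.
\<close>

lemma three_point_quadrature:
  fixes x y c1 c2 :: real
  defines "P \<equiv> \<lambda>c. 1 + 2 * x * c + 2 * y * (2 * c\<^sup>2 - 1)"
  shows "2 * (1 - c1) * (1 - c2) * (c1 - c2) = (1 + 2 * c1 * c2) * (c1 - c2) * P 1
    + (- 1 - 2 * c2) * (1 - c2) * P c1 + (1 + 2 * c1) * (1 - c1) * P c2"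
  unfolding P_def by (simp add: algebra_simps power2_eq_square)

text \<open>
  Among trigonometric polynomials of degree \<open>2\<close> and mean \<open>1\<close> that are nonnegative on the whole circle,
  the Fejer kernel has the largest value at \<open>0\<close>; it has a double zero at \<open>2 * pi / 3\<close>.
  On the grid that zero splits into simple zeros at the two neighbouring grid angles on either side
  of \<open>2 * pi / 3\<close>. The polynomial is negative only strictly between them, where there is no grid angle,
  so it stays feasible; the quadrature rule proves it optimal.
\<close>

theorem extremal_A_three:
  fixes m q :: nat
  assumes m: "m \<ge> 2" and q: "3 * m < q" "q < 3 * m + 3"
  defines "c1 \<equiv> cos (2 * pi * real m / real q)" and "c2 \<equiv> cos (2 * pi * real (m + 1) / real q)"
  shows "extremal_A (3 / real q) = 2 * (1 - c1) * (1 - c2) / (1 + 2 * c1 * c2) / real q"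
proof -
  define C where "C j = cos (2 * pi * real j * (1 / real q))" for j :: nat
  define P where "P F c = 1 + 2 * F 1 * c + 2 * F 2 * (2 * c\<^sup>2 - 1)" for F :: "nat \<Rightarrow> real" and c
  have qr: "3 * real m < real q" "real q < 3 * real m + 3" "real m \<ge> 2"
    using m q by linarith+
  have C12: "C m = c1" "C (m + 1) = c2" "C 0 = 1" by (simp_all add: C_def c1_def c2_def)
  have T: "grid_transform 3 q F j = P F (C j)" for F j
  proof -
    have "cos (2 * pi * real j * (2 / real q)) = 2 * (C j)\<^sup>2 - 1"
      using cos_double_cos[of "2 * pi * real j * (1 / real q)"] by (simp add: C_def mult_ac)
    moreover have "{1..<3::nat} = {1, 2}" by auto
    ultimately show ?thesis by (simp add: grid_transform_def P_def C_def)
  qed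
  \<comment> \<open>The angles of \<open>c1\<close> and \<open>c2\<close> enclose \<open>2 * pi / 3\<close>, and that of \<open>c1\<close> is at least
    \<open>pi / 2\<close>, which makes the denominator positive.\<close>
  have "cos (2 * pi / 3) < c1"
    unfolding c1_def using qr by (intro cos_monotone_0_pi) (auto simp: field_simps)
  then have c1: "- 1 / 2 < c1" by (simp add: cos_120)
  have "c2 < cos (2 * pi / 3)"
  proof -
    have "real (2 * (m + 1)) \<le> real q" using m q by (subst of_nat_le_iff) simp
    then have "2 * (real m + 1) / real q \<le> 1" using qr by simp
    then have "pi * (2 * (real m + 1) / real q) \<le> pi * 1" by (intro mult_left_mono) auto
    moreover have "2 / 3 < 2 * (real m + 1) / real q" using qr by (simp add: field_simps)
    then have "pi * (2 / 3) < pi * (2 * (real m + 1) / real q)" by (intro mult_strict_left_mono) auto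
    ultimately show ?thesis
      unfolding c2_def by (intro cos_monotone_0_pi) (auto simp: mult_ac add.commute)
  qed
  then have c2: "c2 < - 1 / 2" by (simp add: cos_120)
  have "c1 \<le> cos (pi / 2)"
  proof -
    have "q \<le> 4 * m" using m q by linarith
    then have "real q \<le> 4 * real m" by linarith
    then show ?thesis
      unfolding c1_def using qr by (intro cos_monotone_0_pi_le) (auto simp: field_simps)
  qed
  then have "c1 \<le> 0" by simp
  then have D: "1 + 2 * c1 * c2 > 0"
    using c2 mult_nonpos_nonpos[of c1 c2] by simp
  define V where "V = 2 * (1 - c1) * (1 - c2) / (1 + 2 * c1 * c2)"
  \<comment> \<open>\<open>F\<close> makes \<open>P F\<close> the quadratic with zeros \<open>c1\<close>, \<open>c2\<close>; the value of \<open>y\<close> normalises its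
    mean over the circle to \<open>1\<close>.\<close>
  define y where "y = 1 / (2 * (1 + 2 * c1 * c2))"
  define F where "F k = (if k = 1 then - 2 * y * (c1 + c2) else y)" for k :: nat
  have y: "y > 0" "2 * y * (1 + 2 * c1 * c2) = 1" using D by (simp_all add: y_def)
  have PF: "P F c = 4 * y * (c - c1) * (c - c2)" for c
    using y(2) by (simp add: P_def F_def algebra_simps power2_eq_square)
  have "extremal_A (real 3 / real q) = V / real q"
  proof (rule extremal_A_eqI[where F = F])
    show "0 \<le> grid_transform 3 q F j" for j
    proof -
      obtain i where i: "2 * i \<le> q" "C j = C i"
        using cos_grid_fold[of q j] q unfolding C_def by auto
      have "C j \<ge> c1 \<and> C j \<ge> c2 \<or> C j \<le> c1 \<and> C j \<le> c2"
      proof (cases "i \<le> m")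
        case True
        then have "C m \<le> C i" unfolding C_def using m q by (intro cos_grid_antimono) auto
        then show ?thesis using i C12 c1 c2 by auto
      next
        case False
        then have "C i \<le> C (m + 1)" unfolding C_def using i m q by (intro cos_grid_antimono) auto
        then show ?thesis using i C12 c1 c2 by auto
      qed
      then have "0 \<le> (C j - c1) * (C j - c2)" by (auto simp: zero_le_mult_iff)
      then show ?thesis using y by (simp add: T PF mult.assoc)
    qed
    show "grid_transform 3 q G 0 \<le> V" if G: "\<And>j. 0 \<le> grid_transform 3 q G j" for G
    proof -
      have "0 \<le> P G c1" "0 \<le> P G c2"
        using G[of m] G[of "m + 1"] by (simp_all only: T C12)
      then have "0 \<le> (- 1 - 2 * c2) * (1 - c2) * P G c1" "0 \<le> (1 + 2 * c1) * (1 - c1) * P G c2"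
        using c1 c2 \<open>c1 \<le> 0\<close> by (auto intro!: mult_nonneg_nonneg)
      then have "(1 + 2 * c1 * c2) * (c1 - c2) * P G 1 \<le> 2 * (1 - c1) * (1 - c2) * (c1 - c2)"
        using three_point_quadrature[of c1 c2 "G 1" "G 2"] by (simp only: P_def)
      then have "((1 + 2 * c1 * c2) * P G 1) * (c1 - c2) \<le> (2 * (1 - c1) * (1 - c2)) * (c1 - c2)"
        by (simp only: mult_ac)
      then have "(1 + 2 * c1 * c2) * P G 1 \<le> 2 * (1 - c1) * (1 - c2)"
        using c1 c2 by (subst (asm) mult_le_cancel_right) auto
      then show ?thesis using D unfolding T C12 V_def by (subst pos_le_divide_eq) (simp_all only: mult.commute)
    qed
    show "grid_transform 3 q F 0 = V" unfolding T C12 PF y_def V_def using D by (simp add: field_simps)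
  qed (use m q in auto)
  then show ?thesis by (simp add: V_def)
qed

section \<open>Asymptotic expansions\<close>

lemma one_plus_sec_taylor: "(\<lambda>t. 1 + 1 / cos t - (2 + t\<^sup>2 / 2 + 5 * t ^ 4 / 24)) \<in> O[at_right 0](\<lambda>t::real. t ^ 6)"
  by real_asymp

text \<open>
  The optimal value for \<open>p = 3\<close> when the two grid angles around \<open>2 * pi / 3\<close> are \<open>2 * pi / 3 - s\<close> and
  \<open>2 * pi / 3 + 2 * s\<close>. For \<open>q = 3 * \<nu> + 1\<close> this happens with \<open>s = 2 * pi / (3 * q)\<close>, and for
  \<open>q = 3 * \<nu> + 2\<close> with \<open>s = - 2 * pi / (3 * q)\<close>, so that one expansion at \<open>0\<close> serves both residues.
\<close>

definition three_gap_value :: "real \<Rightarrow> real" where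
  "three_gap_value s = 2 * (1 - cos (2 * pi / 3 - s)) * (1 - cos (2 * pi / 3 + 2 * s))
     / (1 + 2 * cos (2 * pi / 3 - s) * cos (2 * pi / 3 + 2 * s))"

text \<open>
  Numerator, denominator and claimed expansion all have the form \<open>x + sqrt 3 * y\<close> with \<open>x\<close> and \<open>y\<close>
  free of \<open>sqrt 3\<close>. Clearing the denominator and separating the two components leaves expansions with
  rational coefficients.
\<close>

lemma three_gap_value_taylor:
  "(\<lambda>s. three_gap_value s - (3 + 4 * s\<^sup>2 - 2 * sqrt 3 * s ^ 3  + 28 / 3 * s ^ 4)) \<in> O[at 0](\<lambda>s. s ^ 5)"
proof -
  define N where "N s = 2 * (1 - cos (2 * pi / 3 - s)) * (1 - cos (2 * pi / 3 + 2 * s))" for s :: real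
  define De Do Te To where "De s = 1 + (cos s * cos (2 * s) - 3 * sin s * sin (2 * s)) / 2"
    and "Do s = sin s / 2" and "Te s = 3 + 4 * s\<^sup>2 + 28 / 3 * s ^ 4" and "To s = - 2 * s ^ 3" for s :: real
  define r where "r = sqrt (3::real)"
  have r: "r\<^sup>2 = 3" and r2: "r * (r * z) = 3 * z" for z
    by (simp_all add: r_def flip: mult.assoc)
  have c: "cos (2 * pi / 3 - s) = - cos s / 2 + r * sin s / 2"
    "cos (2 * pi / 3 + s) = - cos s / 2 - r * sin s / 2" for s
    by (simp_all add: cos_add cos_diff cos_120 sin_120 r_def)
  have "cos (2 * pi / 3 - s) * cos (2 * pi / 3 + 2 * s)
      = (cos s * cos (2 * s) - r\<^sup>2 * sin s * sin (2 * s)) / 4 + r * sin (2 * s - s) / 4" for s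
    unfolding c sin_diff by (simp add: field_simps power2_eq_square)
  then have prod: "cos (2 * pi / 3 - s) * cos (2 * pi / 3 + 2 * s)
      = (cos s * cos (2 * s) - 3 * sin s * sin (2 * s)) / 4 + r * sin s / 4" for s
    by (simp add: r)
  have D: "1 + 2 * cos (2 * pi / 3 - s) * cos (2 * pi / 3 + 2 * s) = De s + r * Do s" for s
    unfolding De_def Do_def mult.assoc prod by (simp add: field_simps)
  have N: "N s = 1 + cos s + cos (2 * s) + De s + r * (sin (2 * s) - Do s)" for s
  proof -
    have "N s = 2 - 2 * cos (2 * pi / 3 - s) - 2 * cos (2 * pi / 3 + 2 * s)
        + 2 * (cos (2 * pi / 3 - s) * cos (2 * pi / 3 + 2 * s))"
      by (simp add: N_def algebra_simps)
    then show ?thesis unfolding prod unfolding c De_def Do_def by (simp add: field_simps)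
  qed
  define E U where "E s = 1 + cos s + cos (2 * s) + De s - Te s * De s - 3 * (To s * Do s)"
    and "U s = sin (2 * s) - Do s - Te s * Do s - To s * De s" for s
  have "N s - (Te s + r * To s) * (De s + r * Do s) = E s + r * U s" for s
    unfolding N E_def U_def by (simp add: algebra_simps r2)
  moreover have "E \<in> O[at 0](\<lambda>s. s ^ 5)"
    unfolding E_def[abs_def] De_def Do_def Te_def To_def by real_asymp
  moreover have "U \<in> O[at 0](\<lambda>s. s ^ 5)"
    unfolding U_def[abs_def] De_def Do_def Te_def To_def by real_asymp
  ultimately have num: "(\<lambda>s. N s - (Te s + r * To s) * (De s + r * Do s)) \<in> O[at 0](\<lambda>s. s ^ 5)"
    by (simp only:) (intro sum_in_bigo(1) landau_o.big_mult[of "\<lambda>_. r" _ "\<lambda>_. 1", simplified]; simp)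
  have lim: "((\<lambda>s. De s + r * Do s) \<longlongrightarrow> 3 / 2) (at 0)"
    unfolding De_def Do_def by (auto intro!: tendsto_eq_intros)
  have inv: "(\<lambda>s. inverse (De s + r * Do s)) \<in> O[at 0](\<lambda>_. 1)"
    by (rule bigoI_tendsto[where c = "inverse (3 / 2)"]) (use tendsto_inverse[OF lim] in auto)
  have "eventually (\<lambda>s. De s + r * Do s \<noteq> 0) (at 0)"
    using tendsto_imp_eventually_ne[OF lim, of 0] by simp
  then have "eventually (\<lambda>s. (N s - (Te s + r * To s) * (De s + r * Do s)) * inverse (De s + r * Do s)
     = three_gap_value s - (3 + 4 * s\<^sup>2 - 2 * sqrt 3 * s ^ 3  + 28 / 3 * s ^ 4)) (at 0)"
  proof eventually_elim
    case (elim s)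
    have "three_gap_value s = N s / (De s + r * Do s)"
      by (simp only: three_gap_value_def N_def D)
    moreover have "Te s + r * To s = 3 + 4 * s\<^sup>2 - 2 * sqrt 3 * s ^ 3  + 28 / 3 * s ^ 4"
      by (simp add: Te_def To_def r_def)
    moreover have "(n - t * d) * inverse d = n / d - t" if "d \<noteq> 0" for n t d :: real
      using that by (simp add: field_simps)
    ultimately show ?case using elim by simp
  qed
  then show ?thesis
    using landau_o.big_mult[OF num inv] by (subst landau_o.big.in_cong[symmetric]) simp_all
qed

text \<open>
  The exact formulas hold only along the given sequence of \<open>h\<close>, but the formulas themselves can be
  expanded as functions of a real variable.
\<close>

lemma bigo_along_sequence:
  fixes A B P k :: "real \<Rightarrow> real" and g :: "nat \<Rightarrow> real"
  assumes "filterlim g (at_right 0) at_top"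
    and "\<forall>\<^sub>F \<nu> in at_top. A (g \<nu>) = B (g \<nu>)"
    and "(\<lambda>h. B h - P h) \<in> O[at_right 0](k)"
  shows "(\<lambda>h. A h - P h) \<in> O[filtermap g at_top](k)"
proof -
  have "(\<lambda>h. B h - P h) \<in> O[filtermap g at_top](k)"
    using assms(1,3) by (auto simp: filterlim_def intro: landau_o.big.filter_mono)
  moreover have "\<forall>\<^sub>F h in filtermap g at_top. A h - P h = B h - P h"
    using assms(2) by (simp add: eventually_filtermap eventually_mono)
  ultimately show ?thesis by (subst landau_o.big.in_cong)
qed

lemma two_sample_value_expansion:
  "(\<lambda>h. h / 2 * (1 + 1 / cos (pi * h / 2)) - (h + pi ^ 2 / 16 * h ^ 3 + 5 * pi ^ 4 / 768 * h ^ 5))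
     \<in> O[at_right 0](\<lambda>h. h ^ 7)"
proof -
  have "filterlim (\<lambda>h. pi * h / 2) (at_right 0) (at_right (0::real))"
    by real_asymp
  from landau_o.big.compose[OF one_plus_sec_taylor this]
  have "(\<lambda>h. 1 + 1 / cos (pi * h / 2) - (2 + (pi * h / 2)\<^sup>2 / 2 + 5 * (pi * h / 2) ^ 4 / 24))
      \<in> O[at_right 0](\<lambda>h. h ^ 6)"
    by (simp add: power_divide power_mult_distrib)
  from landau_o.big.mult_left[OF this, of "\<lambda>h. h / 2"]
  have "(\<lambda>h. h / 2 * (1 + 1 / cos (pi * h / 2) - (2 + (pi * h / 2)\<^sup>2 / 2 + 5 * (pi * h / 2) ^ 4 / 24)))
      \<in> O[at_right 0](\<lambda>h. h ^ 7)"
    by (simp add: eval_nat_numeral)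
  also have "(\<lambda>h. h / 2 * (1 + 1 / cos (pi * h / 2) - (2 + (pi * h / 2)\<^sup>2 / 2 + 5 * (pi * h / 2) ^ 4 / 24)))
      = (\<lambda>h. h / 2 * (1 + 1 / cos (pi * h / 2)) - (h + pi ^ 2 / 16 * h ^ 3 + 5 * pi ^ 4 / 768 * h ^ 5))"
    by (simp add: fun_eq_iff right_diff_distrib distrib_left power_divide power_mult_distrib eval_nat_numeral
        mult_ac)
  finally show ?thesis .
qed

lemma three_sample_value_expansion:
  assumes "c \<noteq> 0"
  shows "(\<lambda>h. h / 3 * three_gap_value (c * h)
       - h / 3 * (3 + 4 * (c * h)\<^sup>2 - 2 * sqrt 3 * (c * h) ^ 3 + 28 / 3 * (c * h) ^ 4))
     \<in> O[at_right 0](\<lambda>h. h ^ 6)"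
proof -
  have "((\<lambda>h. c * h) \<longlongrightarrow> 0) (at_right 0)" by (auto intro!: tendsto_eq_intros)
  then have "filterlim (\<lambda>h. c * h) (at 0) (at_right 0)"
    using assms by (auto simp: filterlim_at eventually_at_filter)
  from landau_o.big.compose[OF three_gap_value_taylor this]
  have "(\<lambda>h. three_gap_value (c * h) - (3 + 4 * (c * h)\<^sup>2 - 2 * sqrt 3 * (c * h) ^ 3 + 28 / 3 * (c * h) ^ 4))
      \<in> O[at_right 0](\<lambda>h. h ^ 5)"
    using assms by (simp add: power_mult_distrib)
  from landau_o.big.mult_left[OF this, of "\<lambda>h. h / 3"] show ?thesis
    by (simp add: right_diff_distrib eval_nat_numeral)
qed

theorem corollary1:
  shows "((\<lambda>h. extremal_A h - (h + pi^2 / 16 * h^3 + 5 * pi^4 / 768 * h^5))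
           \<in> O[filtermap (\<lambda>\<nu>::nat. 2 / (2 * real \<nu> + 1)) at_top](\<lambda>h. h^7)) \<and>
         ((\<lambda>h. extremal_A h - (h + 16 * pi^2 / 243 * h^3
             - 16 * pi^3 * sqrt 3 / 2187 * h^4 + 448 * pi^4 / 59049 * h^5))
           \<in> O[filtermap (\<lambda>\<nu>::nat. 3 / (3 * real \<nu> + 1)) at_top](\<lambda>h. h^6)) \<and>
         ((\<lambda>h. extremal_A h - (h + 16 * pi^2 / 243 * h^3
             + 16 * pi^3 * sqrt 3 / 2187 * h^4 + 448 * pi^4 / 59049 * h^5))
           \<in> O[filtermap (\<lambda>\<nu>::nat. 3 / (3 * real \<nu> + 2)) at_top](\<lambda>h. h^6))"
proof (intro conjI)
  show "(\<lambda>h. extremal_A h - (h + pi^2 / 16 * h^3 + 5 * pi^4 / 768 * h^5))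
      \<in> O[filtermap (\<lambda>\<nu>::nat. 2 / (2 * real \<nu> + 1)) at_top](\<lambda>h. h^7)"
  proof (rule bigo_along_sequence[OF _ _ two_sample_value_expansion])
    show "filterlim (\<lambda>\<nu>. 2 / (2 * real \<nu> + 1)) (at_right 0) at_top" by real_asymp
    show "\<forall>\<^sub>F \<nu> in at_top. extremal_A (2 / (2 * real \<nu> + 1))
        = 2 / (2 * real \<nu> + 1) / 2 * (1 + 1 / cos (pi * (2 / (2 * real \<nu> + 1)) / 2))"
      using eventually_ge_at_top[of 2]
    proof eventually_elim
      case (elim \<nu>)
      define q where "q = 2 * \<nu> + 1"
      have q: "real q = 2 * real \<nu> + 1" by (simp add: q_def)
      have "extremal_A (2 / real q) = 2 / real q / 2 * (1 + 1 / cos (pi * (2 / real q) / 2))"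
        using extremal_A_two[OF elim q] by simp
      then show ?case by (simp only: q)
    qed
  qed
next
  have exp: "(\<lambda>h. h / 3 * three_gap_value (2 * pi / 9 * h) - (h + 16 * pi^2 / 243 * h^3
      - 16 * pi^3 * sqrt 3 / 2187 * h^4 + 448 * pi^4 / 59049 * h^5)) \<in> O[at_right 0](\<lambda>h. h ^ 6)"
    using three_sample_value_expansion[of "2 * pi / 9"]
    by (simp add: distrib_left right_diff_distrib power_divide power_mult_distrib eval_nat_numeral mult_ac)
  show "(\<lambda>h. extremal_A h - (h + 16 * pi^2 / 243 * h^3
      - 16 * pi^3 * sqrt 3 / 2187 * h^4 + 448 * pi^4 / 59049 * h^5))
      \<in> O[filtermap (\<lambda>\<nu>::nat. 3 / (3 * real \<nu> + 1)) at_top](\<lambda>h. h^6)"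
  proof (rule bigo_along_sequence[OF _ _ exp])
    show "filterlim (\<lambda>\<nu>. 3 / (3 * real \<nu> + 1)) (at_right 0) at_top" by real_asymp
    show "\<forall>\<^sub>F \<nu> in at_top. extremal_A (3 / (3 * real \<nu> + 1))
        = 3 / (3 * real \<nu> + 1) / 3 * three_gap_value (2 * pi / 9 * (3 / (3 * real \<nu> + 1)))"
      using eventually_ge_at_top[of 2]
    proof eventually_elim
      case (elim \<nu>)
      define q where "q = 3 * \<nu> + 1"
      have q: "real q = 3 * real \<nu> + 1" by (simp add: q_def)
      have pre: "3 * \<nu> < q" "q < 3 * \<nu> + 3" by (simp_all add: q_def)
      have "2 * pi / 3 - 2 * pi / 9 * (3 / real q) = 2 * pi * real \<nu> / real q"
        "2 * pi / 3 + 2 * (2 * pi / 9 * (3 / real q)) = 2 * pi * real (\<nu> + 1) / real q"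
        by (simp_all add: q field_simps)
      then have "three_gap_value (2 * pi / 9 * (3 / real q))
          = 2 * (1 - cos (2 * pi * real \<nu> / real q)) * (1 - cos (2 * pi * real (\<nu> + 1) / real q))
            / (1 + 2 * cos (2 * pi * real \<nu> / real q) * cos (2 * pi * real (\<nu> + 1) / real q))"
        by (simp only: three_gap_value_def)
      then have "extremal_A (3 / real q) = three_gap_value (2 * pi / 9 * (3 / real q)) / real q"
        by (simp only: extremal_A_three[OF elim pre])
      then have "extremal_A (3 / real q) = 3 / real q / 3 * three_gap_value (2 * pi / 9 * (3 / real q))"
        by simp
      then show ?case by (simp only: q)
    qed
  qed
next
  have exp: "(\<lambda>h. h / 3 * three_gap_value (- (2 * pi / 9) * h) - (h + 16 * pi^2 / 243 * h^3
      + 16 * pi^3 * sqrt 3 / 2187 * h^4 + 448 * pi^4 / 59049 * h^5)) \<in> O[at_right 0](\<lambda>h. h ^ 6)"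
    using three_sample_value_expansion[of "- (2 * pi / 9)"]
    by (simp add: distrib_left right_diff_distrib power_divide power_mult_distrib eval_nat_numeral mult_ac)
  show "(\<lambda>h. extremal_A h - (h + 16 * pi^2 / 243 * h^3
      + 16 * pi^3 * sqrt 3 / 2187 * h^4 + 448 * pi^4 / 59049 * h^5))
      \<in> O[filtermap (\<lambda>\<nu>::nat. 3 / (3 * real \<nu> + 2)) at_top](\<lambda>h. h^6)"
  proof (rule bigo_along_sequence[OF _ _ exp])
    show "filterlim (\<lambda>\<nu>. 3 / (3 * real \<nu> + 2)) (at_right 0) at_top" by real_asymp
    show "\<forall>\<^sub>F \<nu> in at_top. extremal_A (3 / (3 * real \<nu> + 2))
        = 3 / (3 * real \<nu> + 2) / 3 * three_gap_value (- (2 * pi / 9) * (3 / (3 * real \<nu> + 2)))"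
      using eventually_ge_at_top[of 2]
    proof eventually_elim
      case (elim \<nu>)
      define q where "q = 3 * \<nu> + 2"
      have q: "real q = 3 * real \<nu> + 2" by (simp add: q_def)
      have pre: "3 * \<nu> < q" "q < 3 * \<nu> + 3" by (simp_all add: q_def)
      \<comment> \<open>For a negative gap parameter the two angles exchange their roles.\<close>
      have "2 * pi / 3 - - (2 * pi / 9) * (3 / real q) = 2 * pi * real (\<nu> + 1) / real q"
        "2 * pi / 3 + 2 * (- (2 * pi / 9) * (3 / real q)) = 2 * pi * real \<nu> / real q"
        by (simp_all add: q field_simps)
      then have "three_gap_value (- (2 * pi / 9) * (3 / real q))
          = 2 * (1 - cos (2 * pi * real \<nu> / real q)) * (1 - cos (2 * pi * real (\<nu> + 1) / real q))
            / (1 + 2 * cos (2 * pi * real \<nu> / real q) * cos (2 * pi * real (\<nu> + 1) / real q))"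
        by (simp only: three_gap_value_def mult_ac)
      then have "extremal_A (3 / real q) = three_gap_value (- (2 * pi / 9) * (3 / real q)) / real q"
        by (simp only: extremal_A_three[OF elim pre])
      then have "extremal_A (3 / real q) = 3 / real q / 3 * three_gap_value (- (2 * pi / 9) * (3 / real q))"
        by simp
      then show ?case by (simp only: q)
    qed
  qed
qed

end
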